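(* Let $k,r$ be positive integers with $r\ge 2$. Then \[ 2k\le\operatorname{R}^{\sharp}_k(\mathcal{B}\,|\,\lozenge_r)\le 3kr-2r-k+1. \]
   Context: $B_n$ is the Boolean lattice of subsets of $[n]=\{1,\dots,n\}$ ordered by inclusion. The $r$-diamond $\lozenge_r$ is the poset on $\{x,y_1,\dots,y_r,z\}$ with $x\le y_i\le z$ for all $i$ and $y_i,y_j$ incomparable for $i\ne j$. An induced copy of a poset $P$ in $B_N$ is the image of an injection $f:P\to B_N$ with $f(a)\subseteq f(b)$ iff $a\le b$. $\operatorname{R}^{\sharp}_k(\mathcal{B}\,|\,P)$ is the smallest $N$ such that for every assignment of one of $k$ colors to each element of $B_N$ there is an induced copy of $P$ all of whose elements have the same color. *)

theory Defs
  imports Main "HOL-Library.Extended_Nat"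
begin

definition boolean_lattice :: "nat \<Rightarrow> nat set set" where
  "boolean_lattice n = Pow {1..n}"

text \<open>
  A poset is given by a carrier set \<open>P\<close> and its order relation \<open>le\<close>,
  of which only the restriction to \<open>P\<close> matters.
\<close>

definition induced_copy ::
    "'a set \<Rightarrow> ('a \<Rightarrow> 'a \<Rightarrow> bool) \<Rightarrow> nat \<Rightarrow> nat set set \<Rightarrow> bool" where
  "induced_copy P le N S \<longleftrightarrow>
     (\<exists>f. inj_on f P \<and> f ` P \<subseteq> boolean_lattice N \<and>
          (\<forall>a\<in>P. \<forall>b\<in>P. f a \<subseteq> f b \<longleftrightarrow> le a b) \<and> S = f ` P)"

definition ramsey_property :: "nat \<Rightarrow> 'a set \<Rightarrow> ('a \<Rightarrow> 'a \<Rightarrow> bool) \<Rightarrow> nat \<Rightarrow> bool" where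
  "ramsey_property k P le N \<longleftrightarrow>
     (\<forall>c :: nat set \<Rightarrow> nat. c ` boolean_lattice N \<subseteq> {1..k} \<longrightarrow>
        (\<exists>S. induced_copy P le N S \<and> (\<exists>j\<in>{1..k}. \<forall>A\<in>S. c A = j)))"

text \<open>
  The value is \<open>\<infinity>\<close> if no \<open>N\<close> has the property, so that a finite upper bound
  includes the existence of such an \<open>N\<close>; otherwise it is the smallest such \<open>N\<close>.
\<close>

definition boolean_ramsey :: "nat \<Rightarrow> 'a set \<Rightarrow> ('a \<Rightarrow> 'a \<Rightarrow> bool) \<Rightarrow> enat" where
  "boolean_ramsey k P le = (INF N\<in>{N. ramsey_property k P le N}. enat N)"

datatype diamond_point = Bottom | Middle nat | Top

definition diamond :: "nat \<Rightarrow> diamond_point set" where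
  "diamond r = {Bottom, Top} \<union> Middle ` {1..r}"

definition diamond_le :: "diamond_point \<Rightarrow> diamond_point \<Rightarrow> bool" where
  "diamond_le a b \<longleftrightarrow> a = b \<or> a = Bottom \<or> b = Top"

end

(* The upper bound is a Lubell-type averaging argument. On every interval [A, B] give the sets C
   the weight 1 / binomial(|B - A|, |C - A|), the probability that a random maximal chain of [A, B]
   passes through C. If A and B belong to a family without an induced diamond, then every level
   strictly between them has at most r - 1 members of the family, each of weight at most
   1 / |B - A|, so the family weighs less than 2 + (r - 1). If an endpoint is not in the family,
   the weight is the average of the weights on the intervals one step shorter at that end. So every
   colour class weighs less than r + 1, whereas the whole lattice weighs N + 1 >= k (r + 1). *)

theory Submission
  imports Defs Complex_Main
begin

section \<open>Lubell weight on an interval\<close>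

text \<open>For finite \<open>B\<close> and \<open>A\<close> contained in \<open>B\<close>, this is
  the expected number of members of \<open>F\<close> on a uniformly random maximal chain from
  \<open>A\<close> to \<open>B\<close>.\<close>

definition lubell :: "'a set set \<Rightarrow> 'a set \<Rightarrow> 'a set \<Rightarrow> real" where
  "lubell F A B = (\<Sum>C | C \<in> F \<and> A \<subseteq> C \<and> C \<subseteq> B. 1 / real (card (B - A) choose card (C - A)))"

lemma finite_interval_in: "finite B \<Longrightarrow> finite {C. C \<in> F \<and> A \<subseteq> C \<and> C \<subseteq> B}"
  by (rule finite_subset[of _ "Pow B"]) auto

text \<open>The first step of a random maximal chain adds a uniformly chosen point of
  \<open>B - A\<close>, and leaving \<open>A\<close> behind loses nothing because \<open>A\<close>
  is not in \<open>F\<close>. The computation is a double count of the pairs of a point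
  \<open>x\<close> and a member \<open>C\<close> containing \<open>x\<close>.\<close>

lemma lubell_insert_average:
  assumes "finite B" "A \<subset> B" "A \<notin> F"
  shows "lubell F A B = (\<Sum>x\<in>B - A. lubell F (insert x A) B) / card (B - A)"
proof -
  define S where "S = {C. C \<in> F \<and> A \<subseteq> C \<and> C \<subseteq> B}"
  define m where "m = card (B - A)"
  have finS: "finite S" unfolding S_def using assms(1) by (rule finite_interval_in)
  have m: "m > 0" unfolding m_def using assms by (auto simp: card_gt_0_iff)
  have "lubell F (insert x A) B =
      (\<Sum>C\<in>S. if x \<in> C then 1 / real ((m - 1) choose (card (C - A) - 1)) else 0)"
    if x: "x \<in> B - A" for x
  proof -
    have "card (B - insert x A) = m - 1"
      unfolding m_def using x assms(1) by (metis Diff_insert card_Diff_singleton)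
    moreover have "card (C - insert x A) = card (C - A) - 1" if "x \<in> C" for C
      using that x by (metis DiffD2 DiffI Diff_insert card_Diff_singleton)
    moreover have "{C. C \<in> F \<and> insert x A \<subseteq> C \<and> C \<subseteq> B} = {C \<in> S. x \<in> C}"
      unfolding S_def by auto
    ultimately show ?thesis
      unfolding lubell_def sum.inter_filter[OF finS, symmetric] by (intro sum.cong) auto
  qed
  then have "(\<Sum>x\<in>B - A. lubell F (insert x A) B) =
      (\<Sum>x\<in>B - A. \<Sum>C\<in>S. if x \<in> C then 1 / real ((m - 1) choose (card (C - A) - 1)) else 0)"
    by simp
  also have "\<dots> = (\<Sum>C\<in>S. \<Sum>x\<in>B - A. if x \<in> C then 1 / real ((m - 1) choose (card (C - A) - 1)) else 0)"
    by (rule sum.swap)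
  also have "\<dots> = (\<Sum>C\<in>S. m * (1 / real (m choose card (C - A))))"
  proof (rule sum.cong[OF refl])
    fix C assume C: "C \<in> S"
    let ?c = "card (C - A)"
    have "(\<Sum>x\<in>B - A. if x \<in> C then 1 / real ((m - 1) choose (?c - 1)) else 0) =
        ?c * (1 / real ((m - 1) choose (?c - 1)))"
    proof -
      have "{x \<in> B - A. x \<in> C} = C - A" using C unfolding S_def by auto
      then show ?thesis
        using assms(1) by (simp flip: sum.inter_filter)
    qed
    \<comment> \<open>This is the absorption identity for binomial coefficients. It needs
      \<open>?c > 0\<close>, which is where \<open>A\<close> not being in \<open>F\<close>
      enters.\<close>
    also have "\<dots> = m * (1 / real (m choose ?c))"
    proof -
      have "finite C" using C assms(1) unfolding S_def by (auto intro: finite_subset)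
      moreover have "C - A \<noteq> {}" using C assms(3) unfolding S_def by auto
      ultimately have c: "?c > 0" by (simp add: card_gt_0_iff)
      have cm: "?c \<le> m" unfolding m_def using C assms(1) unfolding S_def
        by (intro card_mono) auto
      have "?c * (m choose ?c) = m * ((m - 1) choose (?c - 1))"
        using times_binomial_minus1_eq[OF c] by simp
      then have "real ?c * real (m choose ?c) = real m * real ((m - 1) choose (?c - 1))"
        by (metis of_nat_mult)
      moreover have "real (m choose ?c) \<noteq> 0" "real ((m - 1) choose (?c - 1)) \<noteq> 0"
        using cm by auto
      ultimately show ?thesis by (simp add: field_simps)
    qed
    finally show "(\<Sum>x\<in>B - A. if x \<in> C then 1 / real ((m - 1) choose (?c - 1)) else 0) =
        m * (1 / real (m choose ?c))" .
  qed
  also have "\<dots> = m * lubell F A B"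
    unfolding lubell_def S_def m_def by (simp add: sum_distrib_left)
  finally show ?thesis using m unfolding m_def by simp
qed

text \<open>Complementation in \<open>B\<close> reverses inclusion, and symmetry of binomial
  coefficients preserves the weights. This turns statements about the lower end of an interval into
  statements about the upper end. Intersecting with \<open>Pow B\<close> keeps sets outside
  \<open>B\<close> from contributing spurious complements.\<close>

lemma lubell_complement:
  assumes "finite B" "A \<subseteq> B"
  shows "lubell ((\<lambda>C. B - C) ` (F \<inter> Pow B)) {} (B - A) = lubell F A B"
proof -
  have "(\<Sum>C | C \<in> F \<and> A \<subseteq> C \<and> C \<subseteq> B. 1 / real (card (B - A) choose card (C - A))) =
    (\<Sum>C | C \<in> (\<lambda>C. B - C) ` (F \<inter> Pow B) \<and> {} \<subseteq> C \<and> C \<subseteq> B - A.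
      1 / real (card (B - A) choose card C))"
  proof (rule sum.reindex_bij_witness[of _ "\<lambda>C. B - C" "\<lambda>C. B - C"])
    fix C assume "C \<in> {C. C \<in> F \<and> A \<subseteq> C \<and> C \<subseteq> B}"
    then have C: "A \<subseteq> C" "C \<subseteq> B" by auto
    have "B - C = (B - A) - (C - A)" using C by auto
    then have "card (B - C) = card (B - A) - card (C - A)"
      using C assms by (metis card_Diff_subset Diff_mono finite_Diff finite_subset order_refl)
    moreover have "card (C - A) \<le> card (B - A)"
      using C assms by (intro card_mono) auto
    ultimately show "1 / real (card (B - A) choose card (B - C)) =
        1 / real (card (B - A) choose card (C - A))"
      by (metis binomial_symmetric)
  qed (use assms(2) in \<open>auto simp: double_diff\<close>)
  then show ?thesis unfolding lubell_def by simp
qed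

text \<open>Dual of \<open>lubell_insert_average\<close>: after complementing in \<open>B\<close>,
  the hypothesis on \<open>B\<close> says that the empty set is missing from the family.\<close>

lemma lubell_remove_average:
  assumes "finite B" "A \<subset> B" "B \<notin> F"
  shows "lubell F A B = (\<Sum>x\<in>B - A. lubell F A (B - {x})) / card (B - A)"
proof -
  define G where "G = (\<lambda>C. B - C) ` (F \<inter> Pow B)"
  have "{} \<notin> G" using assms(3) unfolding G_def by auto
  moreover have "{} \<subset> B - A" using assms by auto
  ultimately have "lubell G {} (B - A) =
      (\<Sum>x\<in>B - A. lubell G {x} (B - A)) / card (B - A)"
    using lubell_insert_average[of "B - A" "{}" G] assms(1) by simp
  moreover have "lubell G {} (B - A) = lubell F A B"
    using lubell_complement[of B A F] assms unfolding G_def by simp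
  moreover have "lubell G {x} (B - A) = lubell F A (B - {x})" if x: "x \<in> B - A" for x
  proof -
    \<comment> \<open>For the shorter interval the complements are taken in \<open>B - {x}\<close>
      instead of \<open>B\<close>. They differ from those in \<open>G\<close> exactly by the point
      \<open>x\<close>, so \<open>insert x\<close> matches the two families.\<close>
    let ?H = "(\<lambda>C. (B - {x}) - C) ` (F \<inter> Pow (B - {x}))"
    have "lubell F A (B - {x}) = lubell ?H {} (B - {x} - A)"
    proof -
      have "A \<subseteq> B - {x}" "finite (B - {x})" using assms x by auto
      from lubell_complement[OF this(2,1)] show ?thesis by simp
    qed
    also have "\<dots> = lubell G {x} (B - A)"
      unfolding lubell_def
    proof (rule sum.reindex_bij_witness[of _ "\<lambda>C. C - {x}" "insert x"])
      fix C assume C: "C \<in> {C. C \<in> ?H \<and> {} \<subseteq> C \<and> C \<subseteq> B - {x} - A}"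
      then show "insert x C - {x} = C" by auto
      from C obtain D where D: "D \<in> F" "D \<subseteq> B - {x}" "C = B - {x} - D" by auto
      then have "insert x C = B - D" using x by auto
      then show "insert x C \<in> {C. C \<in> G \<and> {x} \<subseteq> C \<and> C \<subseteq> B - A}"
        using D C x unfolding G_def by auto
      have "B - A - {x} = B - {x} - A" "insert x C - {x} = C - {}" using C by auto
      then show "1 / real (card (B - A - {x}) choose card (insert x C - {x})) =
          1 / real (card (B - {x} - A - {}) choose card (C - {}))" by simp
    next
      fix C assume C: "C \<in> {C. C \<in> G \<and> {x} \<subseteq> C \<and> C \<subseteq> B - A}"
      then show "insert x (C - {x}) = C" by auto
      from C obtain D where D: "D \<in> F" "D \<subseteq> B" "C = B - D" unfolding G_def by auto
      then have "D \<subseteq> B - {x}" "C - {x} = B - {x} - D" using C by auto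
      then show "C - {x} \<in> {C. C \<in> ?H \<and> {} \<subseteq> C \<and> C \<subseteq> B - {x} - A}"
        using D C by auto
    qed
    finally show ?thesis by simp
  qed
  ultimately show ?thesis by simp
qed

text \<open>Each of the \<open>card B + 1\<close> levels has total weight 1, as every maximal chain
  meets it exactly once.\<close>

lemma lubell_Pow:
  assumes "finite B"
  shows "lubell (Pow B) {} B = real (card B + 1)"
proof -
  have "lubell (Pow B) {} B = (\<Sum>C\<in>Pow B. 1 / real (card B choose card C))"
    unfolding lubell_def by (rule sum.cong) auto
  also have "\<dots> = (\<Sum>i\<in>{..card B}. \<Sum>C | C \<in> Pow B \<and> card C = i. 1 / real (card B choose card C))"
    using assms by (intro sum.group[symmetric]) (auto intro: card_mono)
  also have "\<dots> = (\<Sum>i\<in>{..card B}. 1)"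
  proof (rule sum.cong[OF refl])
    fix i assume i: "i \<in> {..card B}"
    have "card {C. C \<in> Pow B \<and> card C = i} = card B choose i"
      using n_subsets[OF assms, of i] by (simp add: Pow_def)
    then show "(\<Sum>C | C \<in> Pow B \<and> card C = i. 1 / real (card B choose card C)) = 1"
      using i by simp
  qed
  finally show ?thesis by simp
qed

section \<open>Families without a diamond\<close>

lemma le_binomial:
  assumes "0 < i" "i < m"
  shows "m \<le> m choose i"
  using assms
proof (induction m arbitrary: i)
  case (Suc m)
  obtain j where j: "i = Suc j" using Suc.prems by (cases i) auto
  show ?case
  proof (cases "i = m")
    case False
    then have "m \<le> m choose i" using Suc by auto
    moreover have "0 < m choose j" using Suc.prems j by simp
    moreover have "Suc m choose i = (m choose j) + (m choose i)" using j by simp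
    ultimately show ?thesis by linarith
  qed simp
qed simp

lemma average_less:
  fixes f :: "'a \<Rightarrow> real"
  assumes "finite S" "S \<noteq> {}" "\<And>x. x \<in> S \<Longrightarrow> f x < b"
  shows "sum f S / card S < b"
proof -
  have "sum f S < (\<Sum>x\<in>S. b)" using assms by (intro sum_strict_mono) auto
  then show ?thesis using assms by (simp add: divide_less_eq card_gt_0_iff mult.commute)
qed

text \<open>The case where averaging stops. It is applied when both ends lie in \<open>F\<close>,
  but the estimate itself only uses the bound on the interior levels.\<close>

lemma lubell_less_levels:
  assumes "r \<ge> 2" "finite B" "A \<subset> B"
    and level: "\<And>i. card {C \<in> F. A \<subset> C \<and> C \<subset> B \<and> card C = i} < r"
  shows "lubell F A B < r + 1"
proof -
  define m where "m = card (B - A)"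
  define M where "M = {C \<in> F. A \<subset> C \<and> C \<subset> B}"
  define w where "w C = 1 / real (m choose card (C - A))" for C
  have finA: "finite A" using assms by (auto intro: finite_subset)
  have m: "m > 0" unfolding m_def using assms by (auto simp: card_gt_0_iff)
  have finM: "finite M" unfolding M_def using assms(2) by (auto intro: finite_subset[of _ "Pow B"])
  \<comment> \<open>Levels are counted relative to \<open>A\<close> in the weights and absolutely in
    \<open>level\<close>; the first equation translates between them.\<close>
  have card_M: "card C = card A + card (C - A)" "0 < card (C - A)" "card (C - A) < m" if "C \<in> M" for C
  proof -
    have C: "A \<subset> C" "C \<subset> B" "finite C" using that assms(2) unfolding M_def by (auto intro: finite_subset)
    then show "card C = card A + card (C - A)"
      using finA by (simp add: card_Diff_subset card_mono psubset_imp_subset)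
    show "0 < card (C - A)" using C by (auto simp: card_gt_0_iff)
    show "card (C - A) < m" unfolding m_def using C assms(2) by (intro psubset_card_mono) auto
  qed
  have "sum w M \<le> (\<Sum>C\<in>M. 1 / real m)"
  proof (rule sum_mono)
    fix C assume "C \<in> M"
    then have "m \<le> m choose card (C - A)" using card_M by (intro le_binomial) auto
    then show "w C \<le> 1 / real m" unfolding w_def using m by (simp add: frac_le)
  qed
  also have "\<dots> = real (card M) / m" by simp
  finally have "sum w M \<le> real (card M) / m" .
  moreover have "card M \<le> (m - 1) * (r - 1)"
  proof -
    have "M = (\<Union>i\<in>{0<..<m}. {C \<in> M. card (C - A) = i})" using card_M by auto
    then have "card M = card (\<Union>i\<in>{0<..<m}. {C \<in> M. card (C - A) = i})" by simp
    also have "\<dots> \<le> (\<Sum>i\<in>{0<..<m}. card {C \<in> M. card (C - A) = i})"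
      by (rule card_UN_le) simp
    also have "\<dots> \<le> (\<Sum>i\<in>{0<..<m}. r - 1)"
    proof (rule sum_mono)
      fix i
      have "{C \<in> M. card (C - A) = i} \<subseteq> {C \<in> F. A \<subset> C \<and> C \<subset> B \<and> card C = card A + i}"
        using card_M(1) unfolding M_def by blast
      moreover have "finite {C \<in> F. A \<subset> C \<and> C \<subset> B \<and> card C = card A + i}"
        using finM unfolding M_def by (rule rev_finite_subset) auto
      ultimately have "card {C \<in> M. card (C - A) = i} < r"
        using level[of "card A + i"] by (meson card_mono le_less_trans)
      then show "card {C \<in> M. card (C - A) = i} \<le> r - 1" by simp
    qed
    finally show ?thesis by simp
  qed
  \<comment> \<open>The strict inequality of the lemma originates here: there are only
    \<open>m - 1\<close> interior levels against weights of at most \<open>1 / m\<close>, and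
    \<open>r - 1\<close> is positive.\<close>
  moreover have "real ((m - 1) * (r - 1)) < real (m * (r - 1))" using m assms(1) by simp
  ultimately have "sum w M < real (r - 1)"
  proof -
    assume le: "sum w M \<le> real (card M) / m" and "card M \<le> (m - 1) * (r - 1)"
      and "real ((m - 1) * (r - 1)) < real (m * (r - 1))"
    then have "real (card M) < real (r - 1) * m" 
      by (metis le_less_trans mult.commute of_nat_le_iff of_nat_mult)
    then have "real (card M) / m < real (r - 1)" using m by (simp only: divide_less_eq of_nat_0_less_iff if_True)
    then show ?thesis using le by linarith
  qed
  \<comment> \<open>Both ends are counted whether or not they belong to \<open>F\<close>. Each has
    weight 1, which gives the summand 2 below.\<close>
  moreover have "lubell F A B \<le> sum w (insert A (insert B M))"
    unfolding lubell_def w_def m_def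
    using finM by (intro sum_mono2) (auto simp: M_def)
  moreover have "sum w (insert A (insert B M)) = 2 + sum w M"
    using assms(3) finM by (auto simp: M_def w_def m_def)
  ultimately show ?thesis using assms(1) by (simp add: of_nat_diff)
qed

text \<open>Induction on the length of the interval. The hypothesis speaks of all subintervals with
  both ends in \<open>F\<close>, so it passes to the shorter intervals that appear in the
  averages.\<close>

lemma lubell_less:
  assumes "r \<ge> 2" "finite B" "A \<subseteq> B"
    and "\<And>A' B' i. A \<subseteq> A' \<Longrightarrow> A' \<subset> B' \<Longrightarrow> B' \<subseteq> B \<Longrightarrow> A' \<in> F \<Longrightarrow> B' \<in> F \<Longrightarrow>
      card {C \<in> F. A' \<subset> C \<and> C \<subset> B' \<and> card C = i} < r"
  shows "lubell F A B < r + 1"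
  using assms(2-)
proof (induction "card (B - A)" arbitrary: A B rule: less_induct)
  case less
  consider "A = B" | "A \<subset> B" "A \<notin> F" | "A \<subset> B" "B \<notin> F" | "A \<subset> B" "A \<in> F" "B \<in> F"
    using less.prems by auto
  then show ?case
  proof cases
    case 1
    have "{C. C \<in> F \<and> B \<subseteq> C \<and> C \<subseteq> B} \<subseteq> {B}" by auto
    then have "lubell F A B \<le> (\<Sum>C\<in>{B}. 1 / real (card (B - A) choose card (C - A)))"
      unfolding lubell_def 1 by (intro sum_mono2) auto
    then show ?thesis using 1 assms(1) by simp
  next
    case 2
    have "lubell F (insert x A) B < r + 1" if x: "x \<in> B - A" for x
    proof (rule less.hyps)
      show "card (B - insert x A) < card (B - A)"
        using x less.prems(1) by (intro psubset_card_mono) auto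
    qed (use x less.prems in auto)
    then show ?thesis
      unfolding lubell_insert_average[OF less.prems(1) 2]
      using 2 less.prems(1) by (intro average_less) auto
  next
    case 3
    have "lubell F A (B - {x}) < r + 1" if x: "x \<in> B - A" for x
    proof (rule less.hyps)
      show "card (B - {x} - A) < card (B - A)"
        using x less.prems(1) by (intro psubset_card_mono) auto
    next
      fix A' B' i
      assume "A \<subseteq> A'" "A' \<subset> B'" "B' \<subseteq> B - {x}" "A' \<in> F" "B' \<in> F"
      then show "card {C \<in> F. A' \<subset> C \<and> C \<subset> B' \<and> card C = i} < r"
        by (intro less.prems(3)) auto
    qed (use x less.prems in auto)
    then show ?thesis
      unfolding lubell_remove_average[OF less.prems(1) 3]
      using 3 less.prems(1) by (intro average_less) auto
  next
    case 4
    then show ?thesis using less.prems assms(1) by (intro lubell_less_levels) auto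
  qed
qed

section \<open>Diamonds from large levels, and the upper bound\<close>

text \<open>Distinct finite sets of equal size are incomparable, so any \<open>r\<close> members of
  \<open>Z\<close> can serve as the middle of a diamond.\<close>

lemma induced_copy_diamondI:
  assumes "B \<subseteq> {1..N}" "A \<subset> B" "r > 0" "r \<le> card Z"
    and Z: "\<And>C. C \<in> Z \<Longrightarrow> A \<subset> C \<and> C \<subset> B \<and> card C = i"
  obtains S where "induced_copy (diamond r) diamond_le N S" "S \<subseteq> insert A (insert B Z)"
proof -
  have finB: "finite B" using assms(1) by (rule finite_subset) simp
  have "finite Z" using Z finB by (auto intro: finite_subset[of _ "Pow B"])
  then obtain g where g: "g ` {1..r} \<subseteq> Z" "inj_on g {1..r}"
    using card_le_inj[of "{1..r}" Z] assms(4) by auto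
  define f where "f p = (case p of Bottom \<Rightarrow> A | Middle j \<Rightarrow> g j | Top \<Rightarrow> B)" for p
  have gZ: "A \<subset> g j" "g j \<subset> B" "card (g j) = i" if "j \<in> {1..r}" for j
    using Z g(1) that by blast+
  have g_le: "g j \<subseteq> g l \<longleftrightarrow> j = l" if "j \<in> {1..r}" "l \<in> {1..r}" for j l
  proof
    assume "g j \<subseteq> g l"
    moreover have "finite (g l)" using gZ(2)[OF that(2)] finB by (auto intro: finite_subset)
    ultimately have "g j = g l" using gZ(3) that by (intro card_subset_eq) auto
    then show "j = l" using g(2) that by (auto dest: inj_onD)
  qed simp
  have le: "\<forall>a\<in>diamond r. \<forall>b\<in>diamond r. f a \<subseteq> f b \<longleftrightarrow> diamond_le a b"
  proof (intro ballI)
    fix p q assume pq: "p \<in> diamond r" "q \<in> diamond r"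
    have "A \<subseteq> g j" "g j \<subseteq> B" "\<not> g j \<subseteq> A" "\<not> B \<subseteq> g j" if "j \<in> {1..r}" for j
      using gZ(1,2)[OF that] by auto
    moreover have "A \<subseteq> B" "\<not> B \<subseteq> A" using assms(2) by auto
    moreover have "j \<in> {1..r}" if "Middle j \<in> diamond r" for j
      using that unfolding diamond_def by auto
    ultimately show "f p \<subseteq> f q \<longleftrightarrow> diamond_le p q"
      using pq g_le by (cases p; cases q) (simp_all add: f_def diamond_le_def)
  qed
  \<comment> \<open>Injectivity follows from the order equivalence \<open>le\<close> and
    antisymmetry of \<open>diamond_le\<close>.\<close>
  have "inj_on f (diamond r)"
  proof (rule inj_onI)
    fix p q assume "p \<in> diamond r" "q \<in> diamond r" "f p = f q"
    then have "diamond_le p q" "diamond_le q p" using le by auto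
    then show "p = q" unfolding diamond_le_def by auto
  qed
  moreover have "f ` diamond r \<subseteq> boolean_lattice N"
  proof -
    have "f p \<subseteq> f Top" if "p \<in> diamond r" for p
      using that le unfolding diamond_le_def by (auto simp: diamond_def)
    moreover have "f Top = B" unfolding f_def by simp
    ultimately have "f p \<subseteq> B" if "p \<in> diamond r" for p using that by simp
    then show ?thesis using assms(1) unfolding boolean_lattice_def by blast
  qed
  ultimately have "induced_copy (diamond r) diamond_le N (f ` diamond r)"
    unfolding induced_copy_def using le by blast
  moreover have "f ` diamond r \<subseteq> insert A (insert B Z)"
    unfolding diamond_def f_def using g(1) by auto
  ultimately show thesis using that by blast
qed

text \<open>Without a monochromatic diamond every colour class satisfies \<open>lubell_less\<close>,
  and the weights of the classes add up to that of the whole lattice.\<close>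

lemma ramsey_property_diamond:
  assumes "r \<ge> 2" "k * (r + 1) \<le> N + 1"
  shows "ramsey_property k (diamond r) diamond_le N"
  unfolding ramsey_property_def
proof (intro allI impI)
  fix c :: "nat set \<Rightarrow> nat"
  assume c: "c ` boolean_lattice N \<subseteq> {1..k}"
  define F where "F j = {C \<in> Pow {1..N}. c C = j}" for j
  show "\<exists>S. induced_copy (diamond r) diamond_le N S \<and> (\<exists>j\<in>{1..k}. \<forall>A\<in>S. c A = j)"
  proof (rule ccontr)
    assume no: "\<not> ?thesis"
    have less: "lubell (F j) {} {1..N} < r + 1" if j: "j \<in> {1..k}" for j
    proof (rule lubell_less[OF assms(1)])
      fix A B :: "nat set" and i
      assume AB: "A \<subset> B" "B \<subseteq> {1..N}" "A \<in> F j" "B \<in> F j"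
      define Z where "Z = {C \<in> F j. A \<subset> C \<and> C \<subset> B \<and> card C = i}"
      have "card Z < r"
      proof (rule ccontr)
        assume "\<not> ?thesis"
        then have Z: "r > 0" "r \<le> card Z" using assms(1) by auto
        have "A \<subset> C \<and> C \<subset> B \<and> card C = i" if "C \<in> Z" for C
          using that unfolding Z_def by simp
        then obtain S where S: "induced_copy (diamond r) diamond_le N S" "S \<subseteq> insert A (insert B Z)"
          by (rule induced_copy_diamondI[OF AB(2,1) Z])
        have "\<forall>C\<in>insert A (insert B Z). c C = j"
          using AB(3,4) unfolding F_def Z_def by simp
        then have "\<forall>A\<in>S. c A = j" using S(2) by blast
        then show False using no S(1) j by blast
      qed
      then show "card {C \<in> F j. A \<subset> C \<and> C \<subset> B \<and> card C = i} < r"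
        unfolding Z_def .
    qed simp_all
    have "real (N + 1) = (\<Sum>C\<in>Pow {1..N}. 1 / real (card {1..N} choose card C))"
      using lubell_Pow[of "{1..N}"] unfolding lubell_def by (simp add: Pow_def)
    also have "\<dots> = (\<Sum>j\<in>{1..k}. \<Sum>C | C \<in> Pow {1..N} \<and> c C = j.
        1 / real (card {1..N} choose card C))"
      using c unfolding boolean_lattice_def by (intro sum.group[symmetric]) auto
    also have "\<dots> = (\<Sum>j\<in>{1..k}. lubell (F j) {} {1..N})"
      unfolding lubell_def F_def by (intro sum.cong) auto
    finally have sum_eq: "real (N + 1) = (\<Sum>j\<in>{1..k}. lubell (F j) {} {1..N})" .
    \<comment> \<open>The lattice is nonempty, so some colour exists; the sum of strict inequalities
      must not be empty.\<close>
    have "k > 0" using c unfolding boolean_lattice_def by (cases k) auto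
    then have "(\<Sum>j\<in>{1..k}. lubell (F j) {} {1..N}) < (\<Sum>j\<in>{1..k}. real (r + 1))"
      using less by (intro sum_strict_mono) auto
    then have "real (N + 1) < real (k * (r + 1))" using sum_eq by (simp add: algebra_simps)
    then show False using assms(2) by linarith
  qed
qed

section \<open>Lower bound\<close>

text \<open>Colouring levels in consecutive pairs rules out a monochromatic 3-chain.\<close>

lemma ramsey_property_diamond_ge:
  assumes "r \<ge> 1" "ramsey_property k (diamond r) diamond_le N"
  shows "2 * k \<le> N"
proof (rule ccontr)
  assume "\<not> 2 * k \<le> N"
  then have N: "N < 2 * k" by simp
  \<comment> \<open>Levels \<open>2 * i\<close> and \<open>2 * i + 1\<close> get colour
    \<open>i + 1\<close>. The levels up to \<open>N < 2 * k\<close> thus need only the colours from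
    1 to \<open>k\<close>.\<close>
  define c :: "nat set \<Rightarrow> nat" where "c A = card A div 2 + 1" for A
  have "c A \<in> {1..k}" if "A \<in> boolean_lattice N" for A
  proof -
    have "card A \<le> N" using that card_mono[of "{1..N}" A] unfolding boolean_lattice_def by auto
    then show ?thesis using N unfolding c_def by auto
  qed
  then have "c ` boolean_lattice N \<subseteq> {1..k}" by auto
  then obtain S j where S: "induced_copy (diamond r) diamond_le N S" "\<forall>A\<in>S. c A = j"
    using assms(2) unfolding ramsey_property_def by blast
  from S(1) obtain f where f: "f ` diamond r \<subseteq> boolean_lattice N" "S = f ` diamond r"
    "\<forall>a\<in>diamond r. \<forall>b\<in>diamond r. f a \<subseteq> f b \<longleftrightarrow> diamond_le a b"
    unfolding induced_copy_def by blast
  have mem: "Bottom \<in> diamond r" "Middle 1 \<in> diamond r" "Top \<in> diamond r"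
    using assms(1) unfolding diamond_def by auto
  have fin: "finite (f p)" if "p \<in> diamond r" for p
    using f(1) that unfolding boolean_lattice_def by (intro finite_subset[of "f p" "{1..N}"]) auto
  have "f Bottom \<subset> f (Middle 1)" "f (Middle 1) \<subset> f Top"
    using f(3) mem by (auto simp: psubset_eq diamond_le_def less_le_not_le)
  then have "card (f Bottom) < card (f (Middle 1))" "card (f (Middle 1)) < card (f Top)"
    using fin mem by (auto intro: psubset_card_mono)
  \<comment> \<open>The sizes of these two sets differ by at least 2, so halving them cannot give
    the same value.\<close>
  moreover have "c (f Bottom) = c (f Top)" using S(2) f(2) mem by auto
  ultimately show False unfolding c_def by simp
qed

theorem theorem5p3:
  fixes k r :: nat
  assumes "k \<ge> 1" and "r \<ge> 2"
  shows "enat (2 * k) \<le> boolean_ramsey k (diamond r) diamond_le \<and>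
         boolean_ramsey k (diamond r) diamond_le \<le> enat (3 * k * r - 2 * r - k + 1)"
proof
  show "enat (2 * k) \<le> boolean_ramsey k (diamond r) diamond_le"
    unfolding boolean_ramsey_def using assms(2)
    by (intro INF_greatest) (auto intro: ramsey_property_diamond_ge[of r])
  \<comment> \<open>This substitution clears the truncated subtractions. The right side of the next
    inequality exceeds the left by \<open>2 * (k - 1) * (r - 1)\<close>.\<close>
  obtain a b where ab: "k = Suc a" "r = Suc (Suc b)"
    using assms by (metis One_nat_def Suc_le_D add_2_eq_Suc le_Suc_ex)
  have "k * (r + 1) \<le> (3 * k * r - 2 * r - k + 1) + 1"
    unfolding ab by (simp add: algebra_simps)
  then show "boolean_ramsey k (diamond r) diamond_le \<le> enat (3 * k * r - 2 * r - k + 1)"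
    unfolding boolean_ramsey_def using assms(2)
    by (intro INF_lower) (auto intro: ramsey_property_diamond)
qed

end
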